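(* In the Banach space setting described in the context (with the listed properties of $Q$, $G$, $\mathcal S$, $\mathcal R$), let $q^\dagger\in\mathcal B_\rho(q_0)$ be a solution of $F(q)=g$. Let $F$ be continuous with respect to $\tau_Q,\tau_G$ and satisfy $$(q_n\stackrel{\tau_Q}{\to}q\ \wedge\ \mathcal S(F(q_n),g)\to0)\ \Rightarrow\ (q\in\mathcal D(F)\ \wedge\ F(q)=g)\qquad\text{for all }(q_n)_{n\in\mathbb N}\subseteq Q,$$ and the generalized tangential cone condition $$\mathcal S\big(F(q),F(\bar q)+F'(q)(q-\bar q)\big)\le c_{tc}^2\,\mathcal S(F(q),F(\bar q))$$ for all $q,\bar q\in Q$ in a neighborhood of $q_0$, with $0<c_{tc}<1$ sufficiently small. Let, further, $\tau>0$ be chosen sufficiently large such that $$c_{\mathcal S}\Big(c_{\mathcal S}c_{tc}^2+\frac{1+c_{\mathcal S}c_{tc}^2}{\tau^2}\Big)<\tilde{\underline\theta}\quad\text{and}\quad 0<\frac{c_{\mathcal S}\tilde{\overline\theta}+c_{\mathcal S}^2c_{tc}^2}{1-c_{\mathcal S}^2c_{tc}^2}<1,$$ and let $\mathcal S(g,g^\delta)\le\delta^2$. Let the discretization errors with respect to the quantities of interest satisfy $|I_{i,h}^k-I_i^k|\le\eta_i^k$, $i\in\{1,2,3,4\}$, where $\eta_1^k,\eta_2^k,\eta_3^k,\eta_4^k$ are selected such that $$\eta_1^k+c_{\mathcal S}^2c_{tc}^2\eta_3^k\le\Big(\tilde{\underline\theta}-c_{\mathcal S}\Big(c_{\mathcal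 S}c_{tc}^2+\frac{1+c_{\mathcal S}c_{tc}^2}{\tau^2}\Big)\Big)I_{3,h}^k,$$ $$\eta_3^k\le c_1I_{3,h}^k\quad\text{and}\quad\eta_2^k\to0,\ \eta_3^k\to0,\ \eta_4^k\to0\ \text{ as }k\to\infty,$$ $$I_{3,h}^k\le(1+c_3)I_{4,h}^{k-1}+r^k\quad\text{and}\quad(1+c_3)\frac{c_{\mathcal S}\tilde{\overline\theta}+c_{\mathcal S}^2c_{tc}^2}{1-c_{\mathcal S}^2c_{tc}^2}\le c_2<1$$ hold for some constants $c_1,c_2,c_3>0$ and a sequence $r^k\to0$ as $k\to\infty$. Let $\beta_k$ and $h=h_k$ fulfil $\tilde{\underline\theta}\,I_{3,h}^k\le I_{2,h}^k\le\tilde{\overline\theta}\,I_{3,h}^k$, and let $k_*$ be selected according to $k_*=\min\{k\in\mathbb N:I_{3,h}^k\le\tau^2\delta^2\}$. Let additionally the multiplicative variational inequality $$|\langle\xi,q-q^\dagger\rangle_{Q^*,Q}|\le c\,D_{\mathcal R}^\xi(q,q^\dagger)^{1/2}f\left(\frac{\mathcal S(F(q),F(q^\dagger))}{D_{\mathcal R}^\xi(q,q^\dagger)}\right)\qquad\text{for all } q\in\mathcal D(F)$$ be fulfilled for some function $f:[0,\infty)\to[0,\infty)$ satisfying: $f(0)=0$; $f^2$ is strictly monotonically increasing; $\phi:=(f^2)^{-1}$ (i.e. $\phi^{-1}(\lambda)=f^2(\lambda)$) is convex; and $\Theta:\lambda\mapsto f(\lambda)\sqrt\lambda$ is strictly monotonically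 increasing. Then there exist a $\bar\delta>0$ and a constant $\bar C>0$ independent of $\delta$ such that for all $\delta\in(0,\bar\delta]$ $$D_{\mathcal R}^\xi(q_h^{k_*},q^\dagger)\le\frac{\bar C^2\delta^2}{\Theta^{-1}\big(\tfrac{\bar C}{c}\delta\big)}=c^2f^2\Big(\Theta^{-1}\big(\tfrac{\bar C}{c}\delta\big)\Big),$$ where $\Theta(\lambda):=f(\lambda)\sqrt\lambda$.
   Context: Spaces and functionals. $Q$ and $G$ are Banach spaces with associated topologies $\tau_Q$ and $\tau_G$ that are weaker than the norm topologies. The data misfit $\mathcal S:G\times G\to\mathbb R$ and the regularization functional $\mathcal R:Q\to[0,+\infty]$, with domain $\mathcal D(\mathcal R)=\{q\in Q:\mathcal R(q)\neq\infty\}$, satisfy: - $y\mapsto\mathcal S(y,g^\delta)$ is convex and sequentially lower semicontinuous with respect to $\tau_G$; - $\mathcal S(y,\tilde y)=\mathcal S(\tilde y,y)$, $\mathcal S(y,\tilde y)\ge0$ and $\mathcal S(y,y)=0$ for all $y,\tilde y\in G$; - there is a constant $c_{\mathcal S}$ with $\mathcal S(y,\tilde y)\le c_{\mathcal S}(\mathcal S(y,\hat y)+\mathcal S(\hat y,\tilde y))$ for all $y,\tilde y,\hat y\in G$; - $\mathcal R$ is proper (its domain is non-empty), convex and $\tau_Q$-lower semicontinuous; - $\mathcal D:=\mathcal D(F)\cap\mathcal D(\mathcal R)\ne\emptyset$ is closed with respect to $\tau_Q$; - for every $C>0$ the set $\{q\in\mathcal D:\mathcal R(q)\le C\}$ is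 $\tau_Q$-sequentially compact in the sense that every sequence in it has a subsequence that is convergent in $Q$ with respect to $\tau_Q$. The Bregman distance is $D_{\mathcal R}^\xi(q,\bar q)=\mathcal R(q)-\mathcal R(\bar q)-\langle\xi,q-\bar q\rangle_{Q^*,Q}$ with some $\xi\in\partial\mathcal R(\bar q)\subset Q^*$ (subdifferential); in the variational inequality and the rate, $\bar q=q^\dagger$, $\xi\in\partial\mathcal R(q^\dagger)$ is a fixed subgradient, and $c>0$ is a constant. Operator. $F=C\circ S$, with domain $\mathcal D(F)\subseteq Q$ and values in $G$, where $C:V\to G$ is a measurement operator and $S:q\mapsto u\in V$ is the parameter-to-solution map of a (possibly nonlinear) PDE given in weak form with test space $W$; this PDE and its linearization are assumed uniquely and stably solvable. $F'(q)$ is the derivative of $F$ at $q$; for the $q_{\mathrm{old}}^k$ below, $F'(q_{\mathrm{old}}^k):Q\to G$ is continuous with respect to $\tau_Q$ and $\tau_G$. $g\in G$ is the exact data and $g^\delta\in G$ the noisy data. $\mathcal B_\rho(q_0)$ is the ball of radius $\rho>0$ around $q_0\in Q$, assumed to be contained in $\mathcal D(F)$. The constants $\tilde{\underline\theta},\tilde{\overline\theta}$ satisfy $0<\tilde{\underline\theta}\le\tilde{\overline\theta}<\frac12$. Discretization. $Q_h,V_h,W_h$ are finite element spaces for $Q,V,W$; $S_h$ is the discrete solution operator of the PDE (solution in $V_h$, test functions in $W_h$), and $F_h=C\circ S_h$ with derivative $F_h'$. The discretization may change from step to step; $h=h_k$ denotes the one in step $k$. Iteration. In step $k$, given $q_{\mathrm{old}}^k\in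 Q_{h_k}$ and $\beta_k>0$: the discrete iterate $q_h^k=q_{h_k}^k$ is a minimizer over $q\in Q_{h_k}$ of $\mathcal S(F_{h_k}'(q_{\mathrm{old}}^k)(q-q_{\mathrm{old}}^k)+F_{h_k}(q_{\mathrm{old}}^k),g^\delta)+\frac1{\beta_k}\mathcal R(q)$; the auxiliary continuous iterate $q^k$ is a minimizer over $q\in Q$ of $\mathcal S(F'(q_{\mathrm{old}}^k)(q-q_{\mathrm{old}}^k)+F(q_{\mathrm{old}}^k),g^\delta)+\frac1{\beta_k}\mathcal R(q)$; and one sets $q_{\mathrm{old}}^{k+1}:=q_{h_k}^k$. The dependence of all iterates on $\delta$ and $g^\delta$ is suppressed in the notation. Quantities of interest. $I_1^k=\mathcal S(F'(q_{\mathrm{old}}^k)(q^k-q_{\mathrm{old}}^k)+F(q_{\mathrm{old}}^k),g^\delta)+\frac1{\beta_k}\mathcal R(q^k)$, $I_2^k=\mathcal S(F'(q_{\mathrm{old}}^k)(q^k-q_{\mathrm{old}}^k)+F(q_{\mathrm{old}}^k),g^\delta)$, $I_3^k=\mathcal S(F(q_{\mathrm{old}}^k),g^\delta)$, $I_4^k=\mathcal S(F(q^k),g^\delta)$; $I_{1,h}^k=\mathcal S(F_{h_k}'(q_{\mathrm{old}}^k)(q_{h_k}^k-q_{\mathrm{old}}^k)+F_{h_k}(q_{\mathrm{old}}^k),g^\delta)+\frac1{\beta_k}\mathcal R(q_{h_k}^k)$, $I_{2,h}^k=\mathcal S(F_{h_k}'(q_{\mathrm{old}}^k)(q_{h_k}^k-q_{\mathrm{old}}^k)+F_{h_k}(q_{\mathrm{old}}^k),g^\delta)$,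 $I_{3,h}^k=\mathcal S(F_{h_k}(q_{\mathrm{old}}^k),g^\delta)$, $I_{4,h}^k=\mathcal S(F_{h_k}(q_{h_k}^k),g^\delta)$.
   Formalization: The claim fails for q_h^{k_*} as indexed; the bound is proved for q_old^{k_*} (= q_h^{k_*-1}), assuming also that q† and q_old^k (k<k_* ) lie in the tangential-cone neighborhood and, if k_*=0, that R(q_old^0) ≤ R(q†). *)

theory Defs
  imports "HOL-Analysis.Analysis"
begin

section \<open>Topologies and functionals\<close>

definition weaker_than_norm :: "'a::real_normed_vector topology \<Rightarrow> bool" where
  "weaker_than_norm T \<longleftrightarrow> topspace T = UNIV \<and> (\<forall>U. openin T U \<longrightarrow> open U)"

definition seq_lsc :: "'a topology \<Rightarrow> ('a \<Rightarrow> real) \<Rightarrow> bool" where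
  "seq_lsc T \<phi> \<longleftrightarrow> (\<forall>x l. limitin T x l sequentially \<longrightarrow>
     ereal (\<phi> l) \<le> liminf (\<lambda>n. ereal (\<phi> (x n))))"

definition lsc_wrt :: "'a topology \<Rightarrow> ('a \<Rightarrow> ereal) \<Rightarrow> bool" where
  "lsc_wrt T R \<longleftrightarrow> (\<forall>a. closedin T {x. R x \<le> a})"

definition ereal_convex :: "('a::real_vector \<Rightarrow> ereal) \<Rightarrow> bool" where
  "ereal_convex R \<longleftrightarrow> (\<forall>x y. \<forall>t\<in>{0..1}.
     R ((1 - t) *\<^sub>R x + t *\<^sub>R y) \<le> ereal (1 - t) * R x + ereal t * R y)"

definition edomain :: "('a \<Rightarrow> ereal) \<Rightarrow> 'a set" where
  "edomain R = {x. R x \<noteq> \<infinity>}"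

definition subdifferential ::
  "('a::real_normed_vector \<Rightarrow> ereal) \<Rightarrow> 'a \<Rightarrow> ('a \<Rightarrow>\<^sub>L real) set" where
  "subdifferential R p = {\<xi>. p \<in> edomain R \<and>
     (\<forall>q. R p + ereal (blinfun_apply \<xi> (q - p)) \<le> R q)}"

definition bregman ::
  "('a::real_normed_vector \<Rightarrow> ereal) \<Rightarrow> ('a \<Rightarrow>\<^sub>L real) \<Rightarrow> 'a \<Rightarrow> 'a \<Rightarrow> ereal" where
  "bregman R \<xi> q p = R q - R p - ereal (blinfun_apply \<xi> (q - p))"

definition misfit ::
  "'g::real_normed_vector topology \<Rightarrow> ('g \<Rightarrow> 'g \<Rightarrow> real) \<Rightarrow> real \<Rightarrow> bool" where
  "misfit \<tau>G S cS \<longleftrightarrow>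
     (\<forall>z. convex_on UNIV (\<lambda>y. S y z) \<and> seq_lsc \<tau>G (\<lambda>y. S y z)) \<and>
     (\<forall>y z. S y z = S z y \<and> 0 \<le> S y z \<and> S y y = 0) \<and>
     (\<forall>y z w. S y z \<le> cS * (S y w + S w z))"

definition regularizer ::
  "'q::real_normed_vector topology \<Rightarrow> 'q set \<Rightarrow> ('q \<Rightarrow> ereal) \<Rightarrow> bool" where
  "regularizer \<tau>Q DF R \<longleftrightarrow>
     (\<forall>q. 0 \<le> R q) \<and> edomain R \<noteq> {} \<and> ereal_convex R \<and> lsc_wrt \<tau>Q R \<and>
     DF \<inter> edomain R \<noteq> {} \<and> closedin \<tau>Q (DF \<inter> edomain R) \<and>
     (\<forall>M>0. \<forall>x::nat \<Rightarrow> 'q. (\<forall>n. x n \<in> DF \<inter> edomain R \<and> R (x n) \<le> ereal M) \<longrightarrow>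
        (\<exists>l s. strict_mono s \<and> limitin \<tau>Q (x \<circ> s) l sequentially))"

section \<open>The PDE and its discretization\<close>

text \<open>
  The weak form of the PDE reads: \<open>A q u\<close> and \<open>b\<close> coincide as functionals on the test space
  \<open>'w\<close>. Stability of the PDE means continuity of the solution in the parameter; stability of the
  linearization means that the partial derivative with respect to the state has a bounded inverse.
\<close>

definition parameter_to_solution ::
  "'q::real_normed_vector set \<Rightarrow>
   ('q \<Rightarrow> 'v::real_normed_vector \<Rightarrow> ('w::real_normed_vector \<Rightarrow>\<^sub>L real)) \<Rightarrow>
   ('w \<Rightarrow>\<^sub>L real) \<Rightarrow> ('q \<Rightarrow> 'v) \<Rightarrow> bool" where
  "parameter_to_solution DF A b sol \<longleftrightarrow>
     (\<forall>q\<in>DF. \<forall>u. (\<forall>w. blinfun_apply (A q u) w = blinfun_apply b w) \<longleftrightarrow> u = sol q) \<and>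
     continuous_on DF sol \<and>
     (\<forall>q\<in>DF. \<exists>A'. ((\<lambda>(p, u). A p u) has_derivative A') (at (q, sol q) within DF \<times> UNIV) \<and>
        (\<forall>r. \<exists>!v. A' (0, v) = r) \<and>
        (\<exists>K. \<forall>v. norm v \<le> K * norm (A' (0, v))))"

definition fe_space :: "'a::real_vector set \<Rightarrow> bool" where
  "fe_space X \<longleftrightarrow> (\<exists>B. finite B \<and> X = span B)"

definition discrete_solution ::
  "'q set \<Rightarrow> ('q \<Rightarrow> 'v \<Rightarrow> ('w::real_normed_vector \<Rightarrow>\<^sub>L real)) \<Rightarrow> ('w \<Rightarrow>\<^sub>L real) \<Rightarrow>
   'v set \<Rightarrow> 'w set \<Rightarrow> ('q \<Rightarrow> 'v) \<Rightarrow> bool" where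
  "discrete_solution X A b Vh Wh solh \<longleftrightarrow> (\<forall>q\<in>X. \<forall>u.
     (u \<in> Vh \<and> (\<forall>w\<in>Wh. blinfun_apply (A q u) w = blinfun_apply b w)) \<longleftrightarrow> u = solh q)"

section \<open>The iteration and its quantities of interest\<close>

text \<open>
  Each quantity takes the forward operator \<open>F\<close> and its derivative \<open>F'\<close> as arguments, so that it
  yields the continuous version at \<open>(F, F')\<close> and the discrete one at \<open>(F\<^sub>h, F\<^sub>h')\<close>. The argument \<open>p\<close>
  is the old iterate and \<open>q\<close> the new one.
\<close>

definition I2 ::
  "('g::real_normed_vector \<Rightarrow> 'g \<Rightarrow> real) \<Rightarrow> ('q \<Rightarrow> 'g) \<Rightarrow> ('q \<Rightarrow> 'q \<Rightarrow> 'g) \<Rightarrow> 'g \<Rightarrow> 'q \<Rightarrow>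
   'q::real_normed_vector \<Rightarrow> real" where
  "I2 S F F' gd p q = S (F' p (q - p) + F p) gd"

definition I1 ::
  "('g::real_normed_vector \<Rightarrow> 'g \<Rightarrow> real) \<Rightarrow> ('q \<Rightarrow> ereal) \<Rightarrow> ('q \<Rightarrow> 'g) \<Rightarrow> ('q \<Rightarrow> 'q \<Rightarrow> 'g) \<Rightarrow> real \<Rightarrow> 'g \<Rightarrow> 'q \<Rightarrow>
   'q::real_normed_vector \<Rightarrow> ereal" where
  "I1 S R F F' \<beta> gd p q = ereal (S (F' p (q - p) + F p) gd) + ereal (1 / \<beta>) * R q"

definition I3 :: "('g \<Rightarrow> 'g \<Rightarrow> real) \<Rightarrow> ('q \<Rightarrow> 'g) \<Rightarrow> 'g \<Rightarrow> 'q \<Rightarrow> real" where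
  "I3 S F gd p = S (F p) gd"

definition I4 :: "('g \<Rightarrow> 'g \<Rightarrow> real) \<Rightarrow> ('q \<Rightarrow> 'g) \<Rightarrow> 'g \<Rightarrow> 'q \<Rightarrow> real" where
  "I4 S F gd q = S (F q) gd"

text \<open>
  The discrepancy \<open>I\<^sub>3\<close> of step \<open>k\<close> is a quantity of the old iterate \<open>qold k\<close>, that is, of the
  outcome \<open>qh (k - 1)\<close> of the previous step. So a stopping rule in terms of \<open>I\<^sub>3\<close> with stopping
  index \<open>k\<close> accepts \<open>qold k\<close>, and the minimization of step \<open>k\<close> is not part of the regularization
  method any more.
\<close>

definition irgnm_iterates ::
  "('g::real_normed_vector \<Rightarrow> 'g \<Rightarrow> real) \<Rightarrow> ('q::real_normed_vector \<Rightarrow> ereal) \<Rightarrow>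
   ('q \<Rightarrow> 'g) \<Rightarrow> ('q \<Rightarrow> 'q \<Rightarrow> 'g) \<Rightarrow> ('h \<Rightarrow> 'q set) \<Rightarrow> ('h \<Rightarrow> 'q \<Rightarrow> 'g) \<Rightarrow> ('h \<Rightarrow> 'q \<Rightarrow> 'q \<Rightarrow> 'g) \<Rightarrow>
   'g \<Rightarrow> (nat \<Rightarrow> 'h) \<Rightarrow> (nat \<Rightarrow> real) \<Rightarrow> (nat \<Rightarrow> 'q) \<Rightarrow> (nat \<Rightarrow> 'q) \<Rightarrow> (nat \<Rightarrow> 'q) \<Rightarrow> bool" where
  "irgnm_iterates S R F F' Qh Fh Fh' gd h \<beta> qold qh q \<longleftrightarrow> (\<forall>k.
     0 < \<beta> k \<and>
     qold k \<in> Qh (h k) \<and>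
     is_arg_min (I1 S R (Fh (h k)) (Fh' (h k)) (\<beta> k) gd (qold k)) (\<lambda>p. p \<in> Qh (h k)) (qh k) \<and>
     is_arg_min (I1 S R F F' (\<beta> k) gd (qold k)) (\<lambda>p. p \<in> UNIV) (q k) \<and>
     qold (Suc k) = qh k)"

definition rate_Theta :: "(real \<Rightarrow> real) \<Rightarrow> real \<Rightarrow> real" where
  "rate_Theta f x = f x * sqrt x"

definition rate_Theta_inv :: "(real \<Rightarrow> real) \<Rightarrow> real \<Rightarrow> real" where
  "rate_Theta_inv f = the_inv_into {0..} (rate_Theta f)"

text \<open>
  The function \<open>(f\<^sup>2)\<inverse>\<close> lives on the range of \<open>f\<^sup>2\<close>, which need not be all of \<open>[0,\<infinity>)\<close>; its convexity
  includes the convexity of that range (see \<open>convex_on\<close>).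
\<close>

definition rate_function :: "(real \<Rightarrow> real) \<Rightarrow> bool" where
  "rate_function f \<longleftrightarrow>
     (\<forall>x\<ge>0. 0 \<le> f x) \<and> f 0 = 0 \<and>
     strict_mono_on {0..} (\<lambda>x. (f x)\<^sup>2) \<and>
     convex_on ((\<lambda>x. (f x)\<^sup>2) ` {0..}) (the_inv_into {0..} (\<lambda>x. (f x)\<^sup>2)) \<and>
     strict_mono_on {0..} (rate_Theta f)"

text \<open>
  The right-hand side is an expression in real numbers only if the Bregman distance \<open>d\<close> is positive
  and finite, so the inequality is required for such \<open>q\<close>.
\<close>

definition variational_inequality ::
  "('g \<Rightarrow> 'g \<Rightarrow> real) \<Rightarrow> ('q::real_normed_vector \<Rightarrow> ereal) \<Rightarrow> 'q set \<Rightarrow> ('q \<Rightarrow> 'g) \<Rightarrow>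
   ('q \<Rightarrow>\<^sub>L real) \<Rightarrow> 'q \<Rightarrow> real \<Rightarrow> (real \<Rightarrow> real) \<Rightarrow> bool" where
  "variational_inequality S R DF F \<xi> qdag c f \<longleftrightarrow> (\<forall>q\<in>DF. \<forall>d>0.
     bregman R \<xi> q qdag = ereal d \<longrightarrow>
     \<bar>blinfun_apply \<xi> (q - qdag)\<bar> \<le> c * sqrt d * f (S (F q) (F qdag) / d))"

end

theory Submission
  imports Defs
begin

text \<open>
  In a step before the stopping index, compare \<open>I\<^sub>1\<close> at its minimizer with its value at \<open>q\<^sup>\<dagger>\<close>. The
  tangential cone condition, the noise bound \<open>\<delta>\<^sup>2 < I\<^sub>3\<^sub>,\<^sub>h / \<tau>\<^sup>2\<close> and the smallness of \<open>\<eta>\<^sub>1\<close> and \<open>\<eta>\<^sub>3\<close>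
  bound the misfit part of the latter by \<open>\<theta>l I\<^sub>3\<^sub>,\<^sub>h \<le> I\<^sub>2\<^sub>,\<^sub>h\<close>, so the new iterate has at most the penalty
  of \<open>q\<^sup>\<dagger>\<close>. Hence the Bregman distance \<open>D\<close> of the accepted iterate is at most
  \<open>\<bar>\<langle>\<xi>, q - q\<^sup>\<dagger>\<rangle>\<bar>\<close>, and the variational inequality with the misfit bound \<open>E\<^sup>2 = O(\<delta>\<^sup>2)\<close> gives
  \<open>D \<le> c \<surd>D f(E\<^sup>2 / D)\<close>, that is \<open>E / c \<le> \<Theta>(E\<^sup>2 / D)\<close>, which is solved for \<open>D\<close>.
\<close>

section \<open>Continuity and inversion of \<open>rate_Theta\<close>\<close>

text \<open>A monotone function can be discontinuous only by jumping, and a jump leaves a gap in its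
  image, which convexity rules out.\<close>

lemma strict_mono_convex_image_continuous:
  fixes f :: "real \<Rightarrow> real"
  assumes mono: "strict_mono_on {0..} f" and conv: "convex (f ` {0..})"
  shows "continuous_on {0..} f"
proof -
  \<comment> \<open>the extension by a line has an open range, as required by \<open>continuous_onI_mono\<close>\<close>
  define G where "G x = (if x < 0 then x + f 0 else f x)" for x
  have f0: "f 0 \<le> f x" if "0 \<le> x" for x
    using that mono by (auto simp: strict_mono_on_def less_eq_real_def)
  have Gmono: "G x < G y" if "x < y" for x y
    using that f0[of y] mono by (auto simp: G_def strict_mono_on_def)
  have "range G = (\<Union>x. {..<G x})"
  proof safe
    fix x show "G x \<in> (\<Union>x. {..<G x})"
      using Gmono[of x "x + 1"] by auto
  next
    fix x w assume w: "w < G x"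
    show "w \<in> range G"
    proof (cases "w < f 0")
      case True
      then have "w = G (w - f 0)" by (simp add: G_def)
      then show ?thesis by blast
    next
      case False
      with w have "0 \<le> x" by (auto simp: G_def split: if_splits)
      with w False have "w \<in> closed_segment (f 0) (f x)"
        by (auto simp: G_def closed_segment_eq_real_ivl)
      also have "\<dots> \<subseteq> f ` {0..}"
        using conv \<open>0 \<le> x\<close> by (intro closed_segment_subset) auto
      finally obtain y where "0 \<le> y" "w = f y" by auto
      then have "w = G y" by (simp add: G_def)
      then show ?thesis by blast
    qed
  qed
  then have "open (range G)" by auto
  then have "continuous_on UNIV G"
    by (rule continuous_onI_mono) (metis Gmono less_eq_real_def)
  then have "continuous_on {0..} G" by (rule continuous_on_subset) simp
  then show ?thesis
    by (subst continuous_on_cong[of _ "{0..}" _ G]) (auto simp: G_def)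
qed

text \<open>Convexity of \<open>\<phi>\<close> includes convexity of its domain, the range of
  \<open>f^2\<close>. So \<open>f^2\<close> has no jumps, and \<open>f\<close> is its square root
  since \<open>f\<close> is nonnegative.\<close>

lemma rate_Theta_continuous:
  assumes "rate_function f"
  shows "continuous_on {0..} (rate_Theta f)"
proof -
  have "continuous_on {0..} (\<lambda>x. (f x)\<^sup>2)"
    using assms
    by (intro strict_mono_convex_image_continuous) (auto simp: rate_function_def convex_on_def)
  then have "continuous_on {0..} (\<lambda>x. sqrt ((f x)\<^sup>2) * sqrt x)"
    by (intro continuous_on_mult continuous_on_real_sqrt continuous_on_id)
  moreover have "sqrt ((f x)\<^sup>2) * sqrt x = rate_Theta f x" if "x \<in> {0..}" for x
    using assms that by (simp add: rate_function_def rate_Theta_def)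
  ultimately show ?thesis
    by (subst continuous_on_cong[OF refl, symmetric]) auto
qed

lemma rate_function_pos:
  assumes "rate_function f" "0 < x"
  shows "0 < f x"
proof -
  have "strict_mono_on {0..} (\<lambda>x. (f x)\<^sup>2)" and nonneg: "0 \<le> f x"
    using assms by (auto simp: rate_function_def)
  then have "(f 0)\<^sup>2 < (f x)\<^sup>2"
    using strict_mono_onD[of _ "\<lambda>x. (f x)\<^sup>2" 0 x] assms(2) by simp
  then have "f x \<noteq> 0" using assms(1) by (auto simp: rate_function_def)
  with nonneg show ?thesis by simp
qed

lemma rate_function_mono:
  assumes "rate_function f" "0 \<le> x" "x \<le> y"
  shows "f x \<le> f y"
proof (rule power2_le_imp_le)
  show "(f x)\<^sup>2 \<le> (f y)\<^sup>2"
    using assms by (auto simp: rate_function_def strict_mono_on_def less_eq_real_def)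
  show "0 \<le> f y"
    using assms by (auto simp: rate_function_def)
qed

text \<open>The bound \<open>rate_Theta f 1\<close> supplies the upper endpoint for the intermediate
  value theorem on \<open>[0,1]\<close>; small noise levels stay below it.\<close>

lemma rate_Theta_inv:
  assumes f: "rate_function f" and t: "0 < t" "t \<le> rate_Theta f 1"
  shows "0 < rate_Theta_inv f t" "rate_Theta f (rate_Theta_inv f t) = t"
proof -
  have inj: "inj_on (rate_Theta f) {0..}"
    using f by (auto simp: rate_function_def intro: strict_mono_on_imp_inj_on)
  have Theta0: "rate_Theta f 0 = 0" by (simp add: rate_Theta_def)
  have "continuous_on {0..1} (rate_Theta f)"
    using rate_Theta_continuous[OF f] by (rule continuous_on_subset) auto
  then obtain y where y: "0 \<le> y" "rate_Theta f y = t"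
    using IVT'[of "rate_Theta f" 0 t 1] t Theta0 by auto
  then have "rate_Theta_inv f t = y"
    unfolding rate_Theta_inv_def using inj by (auto intro: the_inv_into_f_eq)
  moreover have "y \<noteq> 0" using y t Theta0 by auto
  ultimately show "0 < rate_Theta_inv f t" "rate_Theta f (rate_Theta_inv f t) = t"
    using y by auto
qed

section \<open>From an implicit estimate to an explicit rate\<close>

lemma rate_Theta_rate_eq:
  assumes f: "rate_function f" and "0 < c" "0 < E" "E / c \<le> rate_Theta f 1"
  shows "E\<^sup>2 / rate_Theta_inv f (E / c) = c\<^sup>2 * (f (rate_Theta_inv f (E / c)))\<^sup>2"
proof -
  define y where "y = rate_Theta_inv f (E / c)"
  have y: "0 < y" "f y * sqrt y = E / c"
    using rate_Theta_inv[OF f, of "E / c"] assms by (auto simp: y_def rate_Theta_def)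
  then have E: "E = c * (f y * sqrt y)" using \<open>0 < c\<close> by simp
  have "E\<^sup>2 = c\<^sup>2 * (f y)\<^sup>2 * y" unfolding E using y(1) by (simp add: power_mult_distrib)
  then show ?thesis using y by (simp flip: y_def)
qed

text \<open>\<open>D\<close> occurs on both sides, also inside \<open>f\<close>. The substitution
  \<open>x = E^2 / D\<close> collects it: multiplying \<open>sqrt D \<le> c * f x\<close> by
  \<open>sqrt x = E / sqrt D\<close> leaves \<open>E \<le> c * rate_Theta f x\<close>.\<close>

lemma rate_Theta_rate_bound:
  assumes f: "rate_function f" and "0 < c" "0 < E" "E / c \<le> rate_Theta f 1"
    and "0 < D" "D \<le> c * sqrt D * f (E\<^sup>2 / D)"
  shows "D \<le> E\<^sup>2 / rate_Theta_inv f (E / c)"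
proof -
  define x where "x = E\<^sup>2 / D"
  define y where "y = rate_Theta_inv f (E / c)"
  have y: "0 < y" "rate_Theta f y = E / c"
    using rate_Theta_inv[OF f, of "E / c"] assms by (auto simp: y_def)
  have x: "0 < x" using assms by (simp add: x_def)
  have sqrtx: "sqrt x = E / sqrt D"
    using assms by (simp add: x_def real_sqrt_divide)
  have "sqrt D * sqrt D \<le> (c * f x) * sqrt D"
    using assms by (simp add: x_def mult_ac)
  then have "sqrt D \<le> c * f x"
    by (rule mult_right_le_imp_le) (use \<open>0 < D\<close> in simp)
  then have "E / c \<le> rate_Theta f x"
    using assms by (simp add: rate_Theta_def sqrtx field_simps)
  moreover have "strict_mono_on {0..} (rate_Theta f)"
    using f by (simp add: rate_function_def)
  \<comment> \<open>By contradiction: \<open>x < y\<close> would give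
    \<open>rate_Theta f x < rate_Theta f y = E / c\<close>.\<close>
  ultimately have "y \<le> x"
    using strict_mono_onD[of _ "rate_Theta f" x y] x y by force
  then have "D * y \<le> E\<^sup>2" using \<open>0 < D\<close> by (simp add: x_def field_simps)
  then show ?thesis using y by (simp add: field_simps flip: y_def)
qed

text \<open>The penalty comparison leaves only the linear term of the Bregman distance, which is
  what the variational inequality bounds.\<close>

lemma bregman_rate:
  assumes pen: "R p \<le> R qdag" "0 \<le> R p"
    and sub: "\<xi> \<in> subdifferential R qdag"
    and f: "rate_function f"
    and vi: "0 < c" "variational_inequality S R DF F \<xi> qdag c f"
    and p: "p \<in> DF" "0 \<le> S (F p) (F qdag)" "S (F p) (F qdag) \<le> E\<^sup>2"
    and E: "0 < E" "E / c \<le> rate_Theta f 1"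
  shows "bregman R \<xi> p qdag \<le> ereal (E\<^sup>2 / rate_Theta_inv f (E / c))"
proof -
  have sub': "R qdag \<noteq> \<infinity>" "R qdag + ereal (\<xi> (p - qdag)) \<le> R p"
    using sub by (auto simp: subdifferential_def edomain_def)
  obtain a b where ab: "R p = ereal a" "R qdag = ereal b"
    using pen sub' by (cases "R p"; cases "R qdag") auto
  define D where "D = a - b - \<xi> (p - qdag)"
  have breg: "bregman R \<xi> p qdag = ereal D"
    by (simp add: bregman_def ab D_def)
  \<comment> \<open>The subgradient inequality gives the sign; \<open>a \<le> b\<close> gives
    \<open>D \<le> - \<xi> (p - qdag)\<close>.\<close>
  have D0: "0 \<le> D" and Dle: "D \<le> \<bar>\<xi> (p - qdag)\<bar>"
    using sub' pen by (auto simp: ab D_def)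
  have y: "0 < rate_Theta_inv f (E / c)"
    using rate_Theta_inv[OF f, of "E / c"] E vi by auto
  show ?thesis
  proof (cases "D = 0")
    \<comment> \<open>The variational inequality speaks of positive distances only; here the
      nonnegative right-hand side suffices.\<close>
    case True
    then show ?thesis using y by (simp add: breg)
  next
    case False
    with D0 have D: "0 < D" by simp
    note Dle
    also have "\<bar>\<xi> (p - qdag)\<bar> \<le> c * sqrt D * f (S (F p) (F qdag) / D)"
      using vi p D breg by (auto simp: variational_inequality_def)
    also have "\<dots> \<le> c * sqrt D * f (E\<^sup>2 / D)"
      using vi p D by (intro mult_left_mono rate_function_mono[OF f] divide_right_mono) auto
    finally show ?thesis
      using rate_Theta_rate_bound[OF f] vi E D by (simp add: breg)
  qed
qed

section \<open>Penalty comparison in one step before stopping\<close>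

text \<open>\<open>qdag\<close> need not lie in the discrete space, so it competes with the
  continuous minimizer \<open>q\<close>, and \<open>\<eta>1\<close> carries the comparison over to
  \<open>qh\<close>.\<close>

lemma irgnm_step_penalty_le:
  assumes mis: "misfit \<tau>G S cS"
    and R: "\<And>q. 0 \<le> R q" "R qdag \<noteq> \<infinity>"
    and \<beta>: "0 < \<beta>"
    and min: "is_arg_min (I1 S R F F' \<beta> gd p) (\<lambda>q. q \<in> UNIV) q"
    and noise: "S (F qdag) gd \<le> \<delta>\<^sup>2"
    and tcc: "S (F qdag) (F p + F' p (qdag - p)) \<le> ctc\<^sup>2 * S (F qdag) (F p)"
    and e1: "\<bar>I1 S R Fh Fh' \<beta> gd p qh - I1 S R F F' \<beta> gd p q\<bar> \<le> ereal \<eta>1"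
    and e3: "\<bar>I3 S Fh gd p - I3 S F gd p\<bar> \<le> \<eta>3"
    and \<eta>: "\<eta>1 + cS\<^sup>2 * ctc\<^sup>2 * \<eta>3
             \<le> (\<theta>l - cS * (cS * ctc\<^sup>2 + (1 + cS * ctc\<^sup>2) / \<tau>\<^sup>2)) * I3 S Fh gd p"
    and \<theta>: "\<theta>l * I3 S Fh gd p \<le> I2 S Fh Fh' gd p qh"
    and \<tau>: "0 < \<tau>" "\<tau>\<^sup>2 * \<delta>\<^sup>2 < I3 S Fh gd p"
  shows "R qh \<le> R qdag"
proof -
  have sym: "S y z = S z y" and nonneg: "0 \<le> S y z"
    and tri: "S y z \<le> cS * (S y w + S w z)" for y z w
    using mis unfolding misfit_def by blast+
  define J where "J = I3 S Fh gd p"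
  define lin where "lin = F' p (qdag - p) + F p"
  have "0 \<le> \<tau>\<^sup>2 * \<delta>\<^sup>2" by simp
  with \<tau> have "0 < J" by (simp only: J_def)
  then have "0 < S (Fh p) gd" by (simp add: J_def I3_def)
  \<comment> \<open>The positive discrepancy forces this: with \<open>cS \<le> 0\<close> the
    quasi-triangle inequality would make \<open>S (Fh p) gd\<close> nonpositive.\<close>
  have cS: "0 < cS"
  proof (rule ccontr)
    assume "\<not> 0 < cS"
    then have "cS * (S (Fh p) gd + S gd gd) \<le> 0"
      using nonneg by (intro mult_nonpos_nonneg add_nonneg_nonneg) auto
    with tri[of "Fh p" gd gd] \<open>0 < S (Fh p) gd\<close> show False by linarith
  qed
  have \<delta>: "\<delta>\<^sup>2 \<le> J / \<tau>\<^sup>2"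
    using \<tau> by (simp add: J_def field_simps)
  have I3: "S gd (F p) \<le> J + \<eta>3"
    using e3 sym[of gd "F p"] by (simp add: J_def I3_def)
  \<comment> \<open>Intermediate point \<open>gd\<close>: the noise bounds one half, the discrete
    discrepancy plus its error \<open>\<eta>3\<close> the other.\<close>
  have "S (F qdag) (F p) \<le> cS * (\<delta>\<^sup>2 + (J + \<eta>3))"
    using cS I3 noise
    by (intro order.trans[OF tri[of "F qdag" "F p" gd]] mult_left_mono add_mono) auto
  then have lin_g: "S lin (F qdag) \<le> ctc\<^sup>2 * (cS * (\<delta>\<^sup>2 + (J + \<eta>3)))"
    using tcc sym[of lin "F qdag"]
    by (auto simp: lin_def add.commute intro: order.trans[OF _ mult_left_mono])
  \<comment> \<open>Intermediate point \<open>F qdag\<close>: the cone condition bounds one half,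
    the noise the other.\<close>
  have "S lin gd \<le> cS * (ctc\<^sup>2 * (cS * (\<delta>\<^sup>2 + (J + \<eta>3))) + \<delta>\<^sup>2)"
    using cS lin_g noise
    by (intro order.trans[OF tri[of lin gd "F qdag"]] mult_left_mono add_mono) auto
  also have "\<dots> = cS\<^sup>2 * ctc\<^sup>2 * (J + \<eta>3) + cS * (1 + cS * ctc\<^sup>2) * \<delta>\<^sup>2"
    by (simp add: algebra_simps power2_eq_square)
  \<comment> \<open>Regrouped so that the factor of \<open>J\<close> is the constant subtracted from
    \<open>\<theta>l\<close> in the condition on \<open>\<eta>1\<close> and
    \<open>\<eta>3\<close>.\<close>
  also have "\<dots> \<le> cS\<^sup>2 * ctc\<^sup>2 * (J + \<eta>3) + cS * (1 + cS * ctc\<^sup>2) * (J / \<tau>\<^sup>2)"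
    using cS \<delta> by (intro add_left_mono mult_left_mono) auto
  also have "\<dots> = cS\<^sup>2 * ctc\<^sup>2 * \<eta>3 + cS * (cS * ctc\<^sup>2 + (1 + cS * ctc\<^sup>2) / \<tau>\<^sup>2) * J"
    by (simp add: algebra_simps power2_eq_square add_divide_distrib)
  also have "\<dots> \<le> \<theta>l * J - \<eta>1"
    using \<eta> by (simp add: J_def algebra_simps)
  also have "\<dots> \<le> I2 S Fh Fh' gd p qh - \<eta>1"
    using \<theta> by (simp add: J_def)
  finally have lin: "S lin gd + \<eta>1 \<le> I2 S Fh Fh' gd p qh" by simp
  obtain b where b: "R qdag = ereal b"
    using R(1)[of qdag] R(2) by (cases "R qdag") auto
  have "I1 S R F F' \<beta> gd p q \<le> I1 S R F F' \<beta> gd p qdag"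
    using min by (auto simp: is_arg_min_def not_less)
  also have "\<dots> = ereal (S lin gd + b / \<beta>)"
    by (simp add: I1_def b lin_def)
  finally have I1: "I1 S R F F' \<beta> gd p q \<le> ereal (S lin gd + b / \<beta>)" .
  \<comment> \<open>The difference in \<open>e1\<close> is one of extended reals. Finiteness of
    \<open>I1\<close> at \<open>q\<close>, and then of \<open>R qh\<close>, allows real
    arithmetic.\<close>
  have "0 \<le> I1 S R F F' \<beta> gd p q"
    unfolding I1_def using R \<beta> nonneg by (intro add_nonneg_nonneg mult_nonneg_nonneg) auto
  with I1 obtain x where x: "I1 S R F F' \<beta> gd p q = ereal x"
    by (cases "I1 S R F F' \<beta> gd p q") auto
  have fin: "R qh \<noteq> \<infinity>"
  proof
    assume "R qh = \<infinity>"
    then show False using e1 \<beta> by (simp add: x I1_def)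
  qed
  then obtain a where a: "R qh = ereal a"
    using R(1)[of qh] by (cases "R qh") auto
  have "I1 S R Fh Fh' \<beta> gd p qh = ereal (I2 S Fh Fh' gd p qh + a / \<beta>)"
    by (simp add: I1_def I2_def a)
  \<comment> \<open>At the end of this chain the discrete misfit stands on both sides and cancels,
    leaving the penalties.\<close>
  with e1 have "I2 S Fh Fh' gd p qh + a / \<beta> \<le> x + \<eta>1"
    by (simp add: x)
  also have "\<dots> \<le> S lin gd + b / \<beta> + \<eta>1" using I1 by (simp add: x)
  also have "\<dots> \<le> I2 S Fh Fh' gd p qh + b / \<beta>" using lin by simp
  finally show ?thesis using \<beta> by (simp add: a b divide_le_cancel)
qed

section \<open>Convergence rate at the stopping index\<close>

theorem theorem4:
  fixes \<tau>Q :: "'q::banach topology" and \<tau>G :: "'g::banach topology"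
    and S :: "'g \<Rightarrow> 'g \<Rightarrow> real" and cS :: real
    and R :: "'q \<Rightarrow> ereal"
    and A :: "'q \<Rightarrow> 'v::real_normed_vector \<Rightarrow> ('w::real_normed_vector \<Rightarrow>\<^sub>L real)"
    and b :: "'w \<Rightarrow>\<^sub>L real"
    and sol :: "'q \<Rightarrow> 'v" and C :: "'v \<Rightarrow> 'g"
    and F :: "'q \<Rightarrow> 'g" and F' :: "'q \<Rightarrow> 'q \<Rightarrow> 'g" and DF U :: "'q set"
    and Qh :: "'h \<Rightarrow> 'q set" and Vh :: "'h \<Rightarrow> 'v set" and Wh :: "'h \<Rightarrow> 'w set"
    and solh :: "'h \<Rightarrow> 'q \<Rightarrow> 'v"
    and Fh :: "'h \<Rightarrow> 'q \<Rightarrow> 'g" and Fh' :: "'h \<Rightarrow> 'q \<Rightarrow> 'q \<Rightarrow> 'g"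
    and q0 qdag :: 'q and g :: 'g and \<xi> :: "'q \<Rightarrow>\<^sub>L real"
    and \<rho> c ctc \<tau> \<theta>l \<theta>u c1 c2 c3 :: real and f :: "real \<Rightarrow> real"
  assumes topologies: "weaker_than_norm \<tau>Q" "weaker_than_norm \<tau>G"
    and misfit: "misfit \<tau>G S cS"
    and regularizer: "regularizer \<tau>Q DF R"
    and pde: "parameter_to_solution DF A b sol"
    and F: "F = C \<circ> sol"
    and F': "\<And>q. q \<in> DF \<Longrightarrow> (F has_derivative F' q) (at q within DF)"
    and fe_spaces: "\<And>h. fe_space (Qh h) \<and> fe_space (Vh h) \<and> fe_space (Wh h)"
    and discrete_pde: "\<And>h. discrete_solution (DF \<inter> Qh h) A b (Vh h) (Wh h) (solh h)"
    and Fh: "\<And>h. Fh h = C \<circ> solh h"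
    and Fh': "\<And>h q. q \<in> DF \<inter> Qh h \<Longrightarrow> (Fh h has_derivative Fh' h q) (at q within DF \<inter> Qh h)"
    and ball: "0 < \<rho>" "ball q0 \<rho> \<subseteq> DF"
    and solution: "qdag \<in> ball q0 \<rho>" "F qdag = g"
    and F_continuous: "continuous_map (subtopology \<tau>Q DF) \<tau>G F"
    and F_closed: "\<And>x q. (\<And>n::nat. x n \<in> DF) \<Longrightarrow> limitin \<tau>Q x q sequentially \<Longrightarrow>
          (\<lambda>n. S (F (x n)) g) \<longlonglongrightarrow> 0 \<Longrightarrow> q \<in> DF \<and> F q = g"
    and ctc: "0 < ctc" "ctc < 1"
    and neighborhood: "q0 \<in> interior U" "U \<subseteq> DF" "qdag \<in> U"
    and tangential_cone: "\<And>q p. q \<in> U \<Longrightarrow> p \<in> U \<Longrightarrow>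
          S (F q) (F p + F' p (q - p)) \<le> ctc\<^sup>2 * S (F q) (F p)"
    and theta: "0 < \<theta>l" "\<theta>l \<le> \<theta>u" "\<theta>u < 1 / 2"
    and tau: "0 < \<tau>"
      "cS * (cS * ctc\<^sup>2 + (1 + cS * ctc\<^sup>2) / \<tau>\<^sup>2) < \<theta>l"
      "0 < (cS * \<theta>u + cS\<^sup>2 * ctc\<^sup>2) / (1 - cS\<^sup>2 * ctc\<^sup>2)"
      "(cS * \<theta>u + cS\<^sup>2 * ctc\<^sup>2) / (1 - cS\<^sup>2 * ctc\<^sup>2) < 1"
    and constants: "0 < c1" "0 < c2" "0 < c3"
      "(1 + c3) * ((cS * \<theta>u + cS\<^sup>2 * ctc\<^sup>2) / (1 - cS\<^sup>2 * ctc\<^sup>2)) \<le> c2" "c2 < 1"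
    and subgradient: "\<xi> \<in> subdifferential R qdag"
    and rate_function: "rate_function f"
    and variational: "0 < c" "variational_inequality S R DF F \<xi> qdag c f"
  shows "\<exists>\<delta>bar>0. \<exists>Cbar>0. \<forall>\<delta>\<in>{0<..\<delta>bar}.
    \<forall>gd h \<beta> qold qh q \<eta>1 \<eta>2 \<eta>3 \<eta>4 r kstar.
      S g gd \<le> \<delta>\<^sup>2 \<longrightarrow>
      irgnm_iterates S R F F' Qh Fh Fh' gd h \<beta> qold qh q \<longrightarrow>
      (\<forall>k. qold k \<in> DF \<and> q k \<in> DF \<and> continuous_map \<tau>Q \<tau>G (F' (qold k))) \<longrightarrow>
      (\<forall>k<kstar. qold k \<in> U) \<longrightarrow>
      (\<forall>k. \<bar>I1 S R (Fh (h k)) (Fh' (h k)) (\<beta> k) gd (qold k) (qh k)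
              - I1 S R F F' (\<beta> k) gd (qold k) (q k)\<bar> \<le> ereal (\<eta>1 k)) \<longrightarrow>
      (\<forall>k. \<bar>I2 S (Fh (h k)) (Fh' (h k)) gd (qold k) (qh k)
              - I2 S F F' gd (qold k) (q k)\<bar> \<le> \<eta>2 k) \<longrightarrow>
      (\<forall>k. \<bar>I3 S (Fh (h k)) gd (qold k) - I3 S F gd (qold k)\<bar> \<le> \<eta>3 k) \<longrightarrow>
      (\<forall>k. \<bar>I4 S (Fh (h k)) gd (qh k) - I4 S F gd (q k)\<bar> \<le> \<eta>4 k) \<longrightarrow>
      (\<forall>k. \<eta>1 k + cS\<^sup>2 * ctc\<^sup>2 * \<eta>3 k
             \<le> (\<theta>l - cS * (cS * ctc\<^sup>2 + (1 + cS * ctc\<^sup>2) / \<tau>\<^sup>2)) * I3 S (Fh (h k)) gd (qold k)) \<longrightarrow>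
      (\<forall>k. \<eta>3 k \<le> c1 * I3 S (Fh (h k)) gd (qold k)) \<longrightarrow>
      \<eta>2 \<longlonglongrightarrow> 0 \<longrightarrow> \<eta>3 \<longlonglongrightarrow> 0 \<longrightarrow> \<eta>4 \<longlonglongrightarrow> 0 \<longrightarrow>
      (\<forall>k. I3 S (Fh (h (Suc k))) gd (qold (Suc k))
             \<le> (1 + c3) * I4 S (Fh (h k)) gd (qh k) + r (Suc k)) \<longrightarrow>
      r \<longlonglongrightarrow> 0 \<longrightarrow>
      (\<forall>k. \<theta>l * I3 S (Fh (h k)) gd (qold k) \<le> I2 S (Fh (h k)) (Fh' (h k)) gd (qold k) (qh k) \<and>
           I2 S (Fh (h k)) (Fh' (h k)) gd (qold k) (qh k) \<le> \<theta>u * I3 S (Fh (h k)) gd (qold k)) \<longrightarrow>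
      I3 S (Fh (h kstar)) gd (qold kstar) \<le> \<tau>\<^sup>2 * \<delta>\<^sup>2 \<longrightarrow>
      (\<forall>k<kstar. \<tau>\<^sup>2 * \<delta>\<^sup>2 < I3 S (Fh (h k)) gd (qold k)) \<longrightarrow>
      (kstar = 0 \<longrightarrow> R (qold 0) \<le> R qdag) \<longrightarrow>
      bregman R \<xi> (qold kstar) qdag
          \<le> ereal (Cbar\<^sup>2 * \<delta>\<^sup>2 / rate_Theta_inv f (Cbar / c * \<delta>)) \<and>
      Cbar\<^sup>2 * \<delta>\<^sup>2 / rate_Theta_inv f (Cbar / c * \<delta>)
          = c\<^sup>2 * (f (rate_Theta_inv f (Cbar / c * \<delta>)))\<^sup>2"
proof -
  \<comment> \<open>A positive majorant of \<open>cS\<close>, whose sign \<open>misfit\<close>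
    leaves open when \<open>S\<close> vanishes.\<close>
  define K where "K = max cS 1"
  \<comment> \<open>The witness for \<open>Cbar\<close>: \<open>(M * \<delta>)^2\<close> bounds the
    misfit at stopping. The discrepancy with its discretization error contributes
    \<open>(1 + c1) * \<tau>^2\<close>, the data noise \<open>1\<close>.\<close>
  define M where "M = sqrt (K * ((1 + c1) * \<tau>\<^sup>2 + 1))"
  have nonneg: "0 \<le> S y z" and tri: "S y z \<le> cS * (S y w + S w z)"
    and sym: "S y z = S z y" for y z w
    using misfit unfolding misfit_def by blast+
  have R0: "0 \<le> R x" for x using regularizer by (simp add: regularizer_def)
  have Rdag: "R qdag \<noteq> \<infinity>"
    using subgradient by (simp add: subdifferential_def edomain_def)
  have "0 < (1 + c1) * \<tau>\<^sup>2 + 1" using constants tau(1) by (intro add_pos_pos mult_pos_pos) auto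
  moreover have "0 < K" by (simp add: K_def)
  ultimately have M: "0 < M" and M2: "M\<^sup>2 = K * ((1 + c1) * \<tau>\<^sup>2 + 1)"
    by (auto simp: M_def less_imp_le)
  \<comment> \<open>Chosen so that \<open>M * \<delta> / c \<le> rate_Theta f 1\<close>, where the
    inverse is under control.\<close>
  define \<delta>bar where "\<delta>bar = rate_Theta f 1 * c / M"
  have "0 < \<delta>bar"
    using M variational(1) rate_function_pos[OF rate_function, of 1]
    by (simp add: \<delta>bar_def rate_Theta_def)
  show ?thesis
  proof (rule exI[of _ \<delta>bar], rule conjI[OF \<open>0 < \<delta>bar\<close>], rule exI[of _ M],
      rule conjI[OF M], intro ballI allI impI conjI)
    fix \<delta> gd h \<beta> qold qh q and \<eta>1 \<eta>2 \<eta>3 \<eta>4 r :: "nat \<Rightarrow> real" and kstar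
    assume "\<delta> \<in> {0<..\<delta>bar}"
    then have \<delta>: "0 < M * \<delta>" "M * \<delta> / c \<le> rate_Theta f 1"
      using M variational(1) by (auto simp: \<delta>bar_def field_simps)
    assume noise: "S g gd \<le> \<delta>\<^sup>2"
      and iter: "irgnm_iterates S R F F' Qh Fh Fh' gd h \<beta> qold qh q"
      and dom: "\<forall>k. qold k \<in> DF \<and> q k \<in> DF \<and> continuous_map \<tau>Q \<tau>G (F' (qold k))"
      and U: "\<forall>k<kstar. qold k \<in> U"
      and e1: "\<forall>k. \<bar>I1 S R (Fh (h k)) (Fh' (h k)) (\<beta> k) gd (qold k) (qh k)
              - I1 S R F F' (\<beta> k) gd (qold k) (q k)\<bar> \<le> ereal (\<eta>1 k)"
      and e3: "\<forall>k. \<bar>I3 S (Fh (h k)) gd (qold k) - I3 S F gd (qold k)\<bar> \<le> \<eta>3 k"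
      and \<eta>: "\<forall>k. \<eta>1 k + cS\<^sup>2 * ctc\<^sup>2 * \<eta>3 k
             \<le> (\<theta>l - cS * (cS * ctc\<^sup>2 + (1 + cS * ctc\<^sup>2) / \<tau>\<^sup>2)) * I3 S (Fh (h k)) gd (qold k)"
      and \<eta>3: "\<forall>k. \<eta>3 k \<le> c1 * I3 S (Fh (h k)) gd (qold k)"
      and \<beta>: "\<forall>k. \<theta>l * I3 S (Fh (h k)) gd (qold k) \<le> I2 S (Fh (h k)) (Fh' (h k)) gd (qold k) (qh k) \<and>
           I2 S (Fh (h k)) (Fh' (h k)) gd (qold k) (qh k) \<le> \<theta>u * I3 S (Fh (h k)) gd (qold k)"
      and stop: "I3 S (Fh (h kstar)) gd (qold kstar) \<le> \<tau>\<^sup>2 * \<delta>\<^sup>2"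
      and before: "\<forall>k<kstar. \<tau>\<^sup>2 * \<delta>\<^sup>2 < I3 S (Fh (h k)) gd (qold k)"
      and start: "kstar = 0 \<longrightarrow> R (qold 0) \<le> R qdag"
    have pen: "R (qold kstar) \<le> R qdag"
    proof (cases kstar)
      case 0
      then show ?thesis using start by simp
    next
      \<comment> \<open>The accepted \<open>qold kstar\<close> is the outcome of step
        \<open>kstar - 1\<close>, whose discrepancy is still above the threshold.\<close>
      case (Suc k)
      have it: "0 < \<beta> k" "qold kstar = qh k"
        "is_arg_min (I1 S R F F' (\<beta> k) gd (qold k)) (\<lambda>p. p \<in> UNIV) (q k)"
        using iter by (auto simp: irgnm_iterates_def Suc)
      have tcc: "S (F qdag) (F (qold k) + F' (qold k) (qdag - qold k))
          \<le> ctc\<^sup>2 * S (F qdag) (F (qold k))"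
        using U Suc neighborhood by (intro tangential_cone) auto
      have "R (qh k) \<le> R qdag"
        using noise[folded solution(2)] \<beta> before Suc
        by (intro irgnm_step_penalty_le[OF misfit R0 Rdag it(1,3) _ tcc e1[rule_format] e3[rule_format]
              \<eta>[rule_format] _ tau(1)]) auto
      then show ?thesis by (simp add: it)
    qed
    \<comment> \<open>The stopping rule tests the discrete operator;
      \<open>\<eta>3 \<le> c1 * I3\<close> transfers its bound to \<open>F\<close>.\<close>
    have "I3 S F gd (qold kstar) \<le> (1 + c1) * I3 S (Fh (h kstar)) gd (qold kstar)"
      using e3[rule_format, of kstar] \<eta>3[rule_format, of kstar] by (simp add: algebra_simps)
    also have "\<dots> \<le> (1 + c1) * (\<tau>\<^sup>2 * \<delta>\<^sup>2)"
      using stop constants by (intro mult_left_mono) auto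
    finally have "S (F (qold kstar)) gd + S gd g \<le> ((1 + c1) * \<tau>\<^sup>2 + 1) * \<delta>\<^sup>2"
      using noise sym[of g gd] by (simp add: I3_def algebra_simps)
    then have "K * (S (F (qold kstar)) gd + S gd g) \<le> K * (((1 + c1) * \<tau>\<^sup>2 + 1) * \<delta>\<^sup>2)"
      using \<open>0 < K\<close> by (intro mult_left_mono) auto
    moreover have "cS * (S (F (qold kstar)) gd + S gd g) \<le> K * (S (F (qold kstar)) gd + S gd g)"
      using nonneg by (intro mult_right_mono) (auto simp: K_def)
    ultimately have "S (F (qold kstar)) (F qdag) \<le> (M * \<delta>)\<^sup>2"
      using tri[of "F (qold kstar)" g gd] solution by (simp add: M2 power_mult_distrib mult_ac)
    then have "bregman R \<xi> (qold kstar) qdag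
        \<le> ereal ((M * \<delta>)\<^sup>2 / rate_Theta_inv f (M * \<delta> / c))"
      using dom nonneg
      by (intro bregman_rate[OF pen R0 subgradient rate_function variational _ _ _ \<delta>]) auto
    then show "bregman R \<xi> (qold kstar) qdag
        \<le> ereal (M\<^sup>2 * \<delta>\<^sup>2 / rate_Theta_inv f (M / c * \<delta>))"
      by (simp add: power_mult_distrib)
    show "M\<^sup>2 * \<delta>\<^sup>2 / rate_Theta_inv f (M / c * \<delta>)
          = c\<^sup>2 * (f (rate_Theta_inv f (M / c * \<delta>)))\<^sup>2"
      using rate_Theta_rate_eq[OF rate_function variational(1) \<delta>] by (simp add: power_mult_distrib)
  qed
qed

end
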